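(* Let $H_1, H_2\in\mathcal{H}$ with $H_1\le H_2$. Then (1) $|E(H_1)|\le |E(H_2)|+1$; (2) $|V(H_1)|\le |V(H_2)|+2$; (3) $\Delta(H_1)\le \Delta(H_2)+1$; moreover, if $\Delta(H_1)=\Delta(H_2)+1$, then $H_1$ contains at most two vertices of degree $\Delta(H_1)$, and if $H_1$ contains two vertices of degree $\Delta(H_2)+1$, they are adjacent; (4) if $H_2$ is not a tree, then $\dim(H_1)\le \dim(H_2)$.
   Context: All graphs are finite and simple, and are considered up to isomorphism. An edge-colored graph is a pair $(G,c)$ with $c\colon E(G)\to\mathbb{N}$ an arbitrary map (not necessarily a proper coloring); it is colored in $t$ or more colors if $|c(E(G))|\ge t$. A subgraph (not necessarily induced) is rainbow if its edges receive pairwise distinct colors. $(G,c)$ is rainbow $H$-free if $G$ contains no rainbow subgraph isomorphic to $H$. For graphs $H_1,H_2$, write $H_1\le H_2$ if there is a positive integer $t$ such that every rainbow $H_1$-free edge-colored complete graph colored in $t$ or more colors is rainbow $H_2$-free. $\mathcal{H}$ denotes the set of connected finite simple graphs other than the paths $P_1,P_2,P_3,P_4$ ($P_k$ is the path on $k$ vertices). $\Delta(G)$ is the maximum degree. For a connected graph $G$, $\dim G=|E(G)|-|V(G)|+1$. *)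

theory Defs
  imports Main
begin

type_synonym 'a graph = "'a set \<times> 'a set set"

abbreviation verts :: "'a graph \<Rightarrow> 'a set" where
  "verts G \<equiv> fst G"

abbreviation edges :: "'a graph \<Rightarrow> 'a set set" where
  "edges G \<equiv> snd G"

definition simple_graph :: "'a graph \<Rightarrow> bool" where
  "simple_graph G \<longleftrightarrow> finite (verts G) \<and> (\<forall>e\<in>edges G. e \<subseteq> verts G \<and> card e = 2)"

definition subgraph :: "'a graph \<Rightarrow> 'a graph \<Rightarrow> bool" where
  "subgraph F G \<longleftrightarrow> simple_graph F \<and> verts F \<subseteq> verts G \<and> edges F \<subseteq> edges G"

definition graph_iso :: "'a graph \<Rightarrow> 'b graph \<Rightarrow> bool" where
  "graph_iso G H \<longleftrightarrow>
     (\<exists>f. bij_betw f (verts G) (verts H) \<and>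
          (\<forall>u\<in>verts G. \<forall>v\<in>verts G. {u, v} \<in> edges G \<longleftrightarrow> {f u, f v} \<in> edges H))"

definition connected_graph :: "'a graph \<Rightarrow> bool" where
  "connected_graph G \<longleftrightarrow>
     verts G \<noteq> {} \<and>
     (\<forall>u\<in>verts G. \<forall>v\<in>verts G. (u, v) \<in> {(x, y). {x, y} \<in> edges G}\<^sup>*)"

definition is_cycle :: "'a graph \<Rightarrow> 'a list \<Rightarrow> bool" where
  "is_cycle G vs \<longleftrightarrow>
     3 \<le> length vs \<and> distinct vs \<and> set vs \<subseteq> verts G \<and>
     (\<forall>i<length vs. {vs ! i, vs ! (Suc i mod length vs)} \<in> edges G)"

definition is_tree :: "'a graph \<Rightarrow> bool" where
  "is_tree G \<longleftrightarrow> connected_graph G \<and> \<not> (\<exists>vs. is_cycle G vs)"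

definition degree :: "'a graph \<Rightarrow> 'a \<Rightarrow> nat" where
  "degree G v = card {e \<in> edges G. v \<in> e}"

definition max_degree :: "'a graph \<Rightarrow> nat" where
  "max_degree G = Max (degree G ` verts G)"

definition graph_dim :: "'a graph \<Rightarrow> int" where
  "graph_dim G = int (card (edges G)) - int (card (verts G)) + 1"

text \<open>The path on \<open>k\<close> vertices, so with \<open>k - 1\<close> edges.\<close>

definition path_graph :: "nat \<Rightarrow> nat graph" where
  "path_graph k = ({..<k}, {{i, Suc i} | i. Suc i < k})"

definition complete_graph :: "'a set \<Rightarrow> 'a graph" where
  "complete_graph V = (V, {e. e \<subseteq> V \<and> card e = 2})"

text \<open>
  An edge coloring of \<open>G\<close> is a total function on sets of vertices; only its values on
  \<open>edges G\<close> are ever used.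
\<close>

definition rainbow :: "'a graph \<Rightarrow> ('a set \<Rightarrow> nat) \<Rightarrow> bool" where
  "rainbow F c \<longleftrightarrow> inj_on c (edges F)"

definition rainbow_free :: "'h graph \<Rightarrow> 'a graph \<Rightarrow> ('a set \<Rightarrow> nat) \<Rightarrow> bool" where
  "rainbow_free H G c \<longleftrightarrow> \<not> (\<exists>F. subgraph F G \<and> rainbow F c \<and> graph_iso F H)"

definition colored_in_at_least :: "nat \<Rightarrow> 'a graph \<Rightarrow> ('a set \<Rightarrow> nat) \<Rightarrow> bool" where
  "colored_in_at_least t G c \<longleftrightarrow> t \<le> card (c ` edges G)"

text \<open>
  The colored complete graphs have natural numbers as vertices. Up to isomorphism these are
  all finite complete graphs, and a definition cannot quantify over the vertex type.
\<close>

definition rainbow_le :: "'a graph \<Rightarrow> 'b graph \<Rightarrow> bool" where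
  "rainbow_le H1 H2 \<longleftrightarrow>
     (\<exists>t>0. \<forall>(V :: nat set) c.
        finite V \<and> colored_in_at_least t (complete_graph V) c \<and>
        rainbow_free H1 (complete_graph V) c \<longrightarrow>
        rainbow_free H2 (complete_graph V) c)"

definition admissible :: "'a graph \<Rightarrow> bool" where
  "admissible G \<longleftrightarrow>
     simple_graph G \<and> connected_graph G \<and> (\<forall>k\<in>{1..4}. \<not> graph_iso G (path_graph k))"

end

theory Submission
  imports Defs
begin

text \<open>
  Everything follows from one coloring of a large complete graph. Place a copy of \<open>H2\<close> on a
  vertex set \<open>A\<close> and add a large matching \<open>M\<close> outside \<open>A\<close>. Color the edges of the copy and of
  \<open>M\<close> with pairwise distinct colors, and give every other edge the color of one edge \<open>e0\<close> of the
  copy; if \<open>H2\<close> is not a tree, \<open>e0\<close> is taken on a cycle. A rainbow copy \<open>F\<close> of \<open>H1\<close> then has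
  at most one edge \<open>f\<close> outside \<open>M\<close> and the copy of \<open>H2\<close> minus \<open>e0\<close>. As \<open>F\<close> is connected and
  \<open>f\<close> meets at most two matching edges, either \<open>F\<close> is a path with at most four vertices, or
  \<open>F\<close> lives on \<open>A\<close> together with a single matching edge, and all four claims are counting.
\<close>

section \<open>Graph isomorphisms\<close>

text \<open>A copy is encoded as a literal relabelling, so that edges and degrees are transported by
  image lemmas. It is a faithful copy when \<open>g\<close> is injective on the vertices.\<close>

definition map_graph :: "('a \<Rightarrow> 'b) \<Rightarrow> 'a graph \<Rightarrow> 'b graph" where
  "map_graph g G = (g ` verts G, (`) g ` edges G)"

lemma verts_map_graph [simp]: "verts (map_graph g G) = g ` verts G"
  and edges_map_graph [simp]: "edges (map_graph g G) = (`) g ` edges G"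
  by (simp_all add: map_graph_def)

lemma simple_graph_edge:
  assumes "simple_graph G" "e \<in> edges G"
  shows "e \<subseteq> verts G" "card e = 2"
  using assms by (auto simp: simple_graph_def)

lemma simple_graph_finite_verts: "simple_graph G \<Longrightarrow> finite (verts G)"
  by (simp add: simple_graph_def)

lemma simple_graph_finite_edges:
  assumes "simple_graph G"
  shows "finite (edges G)"
proof (rule finite_subset)
  show "edges G \<subseteq> Pow (verts G)" using assms by (auto simp: simple_graph_def)
  show "finite (Pow (verts G))" using assms by (simp add: simple_graph_def)
qed

lemma simple_graph_edgeE:
  assumes "simple_graph G" "e \<in> edges G"
  obtains x y where "e = {x, y}" "x \<noteq> y" "x \<in> verts G" "y \<in> verts G"
proof -
  from simple_graph_edge(2)[OF assms] obtain x y where xy: "e = {x, y}" "x \<noteq> y"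
    unfolding card_2_iff by blast
  with simple_graph_edge(1)[OF assms] show ?thesis by (intro that[OF xy]) auto
qed

lemma graph_iso_sym:
  assumes "graph_iso G H"
  shows "graph_iso H G"
proof -
  obtain f where f: "bij_betw f (verts G) (verts H)"
    and e: "\<And>u v. u \<in> verts G \<Longrightarrow> v \<in> verts G \<Longrightarrow> {u, v} \<in> edges G \<longleftrightarrow> {f u, f v} \<in> edges H"
    using assms by (auto simp: graph_iso_def)
  let ?g = "inv_into (verts G) f"
  have g: "bij_betw ?g (verts H) (verts G)"
    by (rule bij_betw_inv_into[OF f])
  moreover have "{u, v} \<in> edges H \<longleftrightarrow> {?g u, ?g v} \<in> edges G"
    if "u \<in> verts H" "v \<in> verts H" for u v
    using that e[of "?g u" "?g v"] bij_betwE[OF g] bij_betw_inv_into_right[OF f] by simp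
  ultimately show ?thesis unfolding graph_iso_def by blast
qed

lemma graph_iso_trans:
  assumes "graph_iso G H" "graph_iso H K"
  shows "graph_iso G K"
proof -
  obtain f where f: "bij_betw f (verts G) (verts H)"
    and ef: "\<And>u v. u \<in> verts G \<Longrightarrow> v \<in> verts G \<Longrightarrow> {u, v} \<in> edges G \<longleftrightarrow> {f u, f v} \<in> edges H"
    using assms(1) by (auto simp: graph_iso_def)
  obtain g where g: "bij_betw g (verts H) (verts K)"
    and eg: "\<And>u v. u \<in> verts H \<Longrightarrow> v \<in> verts H \<Longrightarrow> {u, v} \<in> edges H \<longleftrightarrow> {g u, g v} \<in> edges K"
    using assms(2) by (auto simp: graph_iso_def)
  have "{u, v} \<in> edges G \<longleftrightarrow> {(g \<circ> f) u, (g \<circ> f) v} \<in> edges K"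
    if "u \<in> verts G" "v \<in> verts G" for u v
    using that ef[of u v] eg[of "f u" "f v"] bij_betwE[OF f] by simp
  then show ?thesis unfolding graph_iso_def using bij_betw_trans[OF f g] by blast
qed

lemma doubleton_mem_map_graph:
  assumes "simple_graph G" "inj_on g (verts G)" "u \<in> verts G" "v \<in> verts G"
  shows "{g u, g v} \<in> edges (map_graph g G) \<longleftrightarrow> {u, v} \<in> edges G"
proof
  assume "{g u, g v} \<in> edges (map_graph g G)"
  then obtain e where e: "e \<in> edges G" "g ` e = g ` {u, v}" by auto
  have "e = {u, v}"
    using inj_on_image_eq_iff[OF assms(2)] simple_graph_edge(1)[OF assms(1) e(1)] e(2) assms(3,4)
    by (metis empty_subsetI insert_subset)
  with e show "{u, v} \<in> edges G" by simp
next
  assume "{u, v} \<in> edges G"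
  then show "{g u, g v} \<in> edges (map_graph g G)" using imageI[of "{u, v}" "edges G" "(`) g"] by simp
qed

lemma graph_iso_map_graph:
  assumes "simple_graph G" "inj_on g (verts G)"
  shows "graph_iso G (map_graph g G)"
  unfolding graph_iso_def
  using doubleton_mem_map_graph[OF assms] assms(2) by (intro exI[of _ g]) (auto simp: bij_betw_def)

text \<open>\<open>graph_iso\<close> compares only pairs of vertices; since both graphs are simple,
  these pairs account for all edges, and the isomorphism becomes an equality of graphs.\<close>

lemma graph_iso_imp_map_graph:
  assumes "simple_graph G" "simple_graph H" "graph_iso G H"
  obtains g where "inj_on g (verts G)" "H = map_graph g G"
proof -
  obtain g where g: "bij_betw g (verts G) (verts H)"
    and e: "\<And>u v. u \<in> verts G \<Longrightarrow> v \<in> verts G \<Longrightarrow> {u, v} \<in> edges G \<longleftrightarrow> {g u, g v} \<in> edges H"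
    using assms(3) by (auto simp: graph_iso_def)
  have v: "verts H = g ` verts G" using g by (simp add: bij_betw_def)
  have "edges H = (`) g ` edges G"
  proof (rule set_eqI, rule iffI)
    fix d assume d: "d \<in> edges H"
    with assms(2) obtain x y where "d = {x, y}" "x \<in> verts H" "y \<in> verts H"
      by (rule simple_graph_edgeE)
    then obtain u w where uw: "u \<in> verts G" "w \<in> verts G" "d = {g u, g w}" using v by auto
    then have "{u, w} \<in> edges G" using e d by simp
    then show "d \<in> (`) g ` edges G" using uw(3) imageI[of "{u, w}" "edges G" "(`) g"] by simp
  next
    fix d assume "d \<in> (`) g ` edges G"
    then obtain k where k: "k \<in> edges G" "d = g ` k" by blast
    with assms(1) obtain x y where "k = {x, y}" "x \<in> verts G" "y \<in> verts G"
      by (auto elim: simple_graph_edgeE)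
    then show "d \<in> edges H" using e[of x y] k by simp
  qed
  with v have "H = map_graph g G" by (simp add: map_graph_def prod_eq_iff)
  with g show ?thesis by (intro that) (auto simp: bij_betw_def)
qed

lemma simple_graph_map_graph:
  assumes "simple_graph G" "inj_on g (verts G)"
  shows "simple_graph (map_graph g G)"
proof -
  have "card (g ` e) = 2" if "e \<in> edges G" for e
    using simple_graph_edge[OF assms(1) that] card_image[OF inj_on_subset[OF assms(2)]] by simp
  then show ?thesis
    using assms(1) unfolding simple_graph_def by auto
qed

lemma inj_on_image_edges:
  assumes "simple_graph G" "inj_on g (verts G)"
  shows "inj_on ((`) g) (edges G)"
  by (rule inj_onI) (metis assms inj_on_image_eq_iff simple_graph_edge(1))

section \<open>Quantities preserved by relabelling\<close>

lemma card_verts_map_graph: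
  "inj_on g (verts G) \<Longrightarrow> card (verts (map_graph g G)) = card (verts G)"
  by (simp add: card_image)

lemma card_edges_map_graph:
  assumes "simple_graph G" "inj_on g (verts G)"
  shows "card (edges (map_graph g G)) = card (edges G)"
  by (simp add: card_image[OF inj_on_image_edges[OF assms]])

lemma degree_map_graph:
  assumes "simple_graph G" "inj_on g (verts G)" "v \<in> verts G"
  shows "degree (map_graph g G) (g v) = degree G v"
proof -
  have "{e \<in> edges (map_graph g G). g v \<in> e} = (`) g ` {e \<in> edges G. v \<in> e}"
    using inj_on_image_mem_iff[OF assms(2,3) simple_graph_edge(1)[OF assms(1)]] by auto
  then show ?thesis
    unfolding degree_def
    using card_image[OF inj_on_subset[OF inj_on_image_edges[OF assms(1,2)]]] by simp
qed

lemma max_degree_map_graph: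
  assumes "simple_graph G" "inj_on g (verts G)"
  shows "max_degree (map_graph g G) = max_degree G"
proof -
  have "degree (map_graph g G) ` verts (map_graph g G) = degree G ` verts G"
    using degree_map_graph[OF assms] by (force simp: image_iff)
  then show ?thesis unfolding max_degree_def by simp
qed

lemma connected_graph_map_graph:
  assumes "connected_graph G"
  shows "connected_graph (map_graph g G)"
proof -
  have step: "(g u, g v) \<in> {(x, y). {x, y} \<in> edges (map_graph g G)}\<^sup>*"
    if "(u, v) \<in> {(x, y). {x, y} \<in> edges G}\<^sup>*" for u v
    using that
  proof induction
    case (step y z)
    then have "{g y, g z} \<in> edges (map_graph g G)"
      using imageI[of "{y, z}" "edges G" "(`) g"] by simp
    with step.IH show ?case by (auto intro: rtrancl_into_rtrancl)
  qed simp
  then show ?thesis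
    using assms unfolding connected_graph_def by auto
qed

lemma degree_le_max_degree:
  "simple_graph G \<Longrightarrow> v \<in> verts G \<Longrightarrow> degree G v \<le> max_degree G"
  unfolding max_degree_def by (simp add: simple_graph_finite_verts)

section \<open>Connected graphs\<close>

text \<open>A walk from \<open>u\<close> to \<open>v\<close> starts inside \<open>X\<close> and ends
  outside it, so some step leaves \<open>X\<close>.\<close>

lemma connected_graph_cut:
  assumes "connected_graph G" "u \<in> verts G" "u \<in> X" "v \<in> verts G" "v \<notin> X"
  obtains x y where "{x, y} \<in> edges G" "x \<in> X" "y \<notin> X"
proof -
  have "(u, v) \<in> {(x, y). {x, y} \<in> edges G}\<^sup>*"
    using assms by (auto simp: connected_graph_def)
  then have "v \<notin> X \<longrightarrow> (\<exists>x y. {x, y} \<in> edges G \<and> x \<in> X \<and> y \<notin> X)"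
    by induction (use assms(3) in auto)
  with assms(5) that show ?thesis by blast
qed

text \<open>The cut property in contrapositive form; with small sets \<open>X\<close> it serves to
  confine rainbow subgraphs.\<close>

lemma connected_graph_subset:
  assumes "connected_graph G" "verts G \<inter> X \<noteq> {}"
    and "\<And>e. e \<in> edges G \<Longrightarrow> e \<subseteq> X \<or> e \<inter> X = {}"
  shows "verts G \<subseteq> X"
proof (rule ccontr)
  assume "\<not> verts G \<subseteq> X"
  then obtain u v where "u \<in> verts G" "u \<in> X" "v \<in> verts G" "v \<notin> X" using assms(2) by blast
  then obtain x y where "{x, y} \<in> edges G" "x \<in> X" "y \<notin> X"
    by (rule connected_graph_cut[OF assms(1)])
  with assms(3) show False by blast
qed

text \<open>\<open>X\<close> grows by one vertex at a time along an edge leaving it, and each new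
  vertex brings an edge of its own. In the dimension count this handles the vertices of the copy of
  \<open>H2\<close> that a rainbow subgraph misses.\<close>

lemma card_edges_outside_ge:
  assumes G: "simple_graph G" "connected_graph G" and "X \<subseteq> verts G" "X \<noteq> {}"
  shows "card (verts G - X) \<le> card {e \<in> edges G. \<not> e \<subseteq> X}"
  using assms(3,4)
proof (induction "card (verts G - X)" arbitrary: X)
  case (Suc k)
  obtain v where v: "v \<in> verts G" "v \<notin> X"
    using Suc.hyps(2) by (metis Diff_eq_empty_iff card.empty nat.distinct(1) subsetI)
  obtain u where u: "u \<in> verts G" "u \<in> X" using Suc.prems by blast
  obtain x y where xy: "{x, y} \<in> edges G" "x \<in> X" "y \<notin> X"
    using connected_graph_cut[OF G(2) u v] by blast
  have y: "y \<in> verts G" using simple_graph_edge(1)[OF G(1) xy(1)] by simp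
  have c: "card (verts G - X) = Suc (card (verts G - insert y X))"
    using xy y simple_graph_finite_verts[OF G(1)]
    by (metis Diff_iff Diff_insert card_Suc_Diff1 finite_Diff)
  \<comment> \<open>The crossing edge \<open>{x, y}\<close> lies inside \<open>insert y X\<close>,
    so the induction hypothesis has not counted it.\<close>
  have "Suc (card (verts G - insert y X)) \<le> Suc (card {e \<in> edges G. \<not> e \<subseteq> insert y X})"
    using Suc.hyps(2) c Suc.prems y by (intro Suc_le_mono[THEN iffD2] Suc.hyps(1)) auto
  also have "\<dots> = card (insert {x, y} {e \<in> edges G. \<not> e \<subseteq> insert y X})"
    using xy(2) simple_graph_finite_edges[OF G(1)] by simp
  also have "\<dots> \<le> card {e \<in> edges G. \<not> e \<subseteq> X}"
    using xy simple_graph_finite_edges[OF G(1)] by (intro card_mono) auto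
  finally show ?case using c by simp
qed simp

text \<open>The closing edge of the cycle is removed: the rest of the cycle still joins its ends, so
  each passage through \<open>e\<close> has a detour.\<close>

lemma connected_graph_delete_cycle_edge:
  assumes "connected_graph G" "is_cycle G vs"
  obtains e where "e \<in> edges G" "connected_graph (verts G, edges G - {e})"
proof -
  define n where "n = length vs"
  define e where "e = {vs ! (n - 1), vs ! 0}"
  define R where "R = {(x, y). {x, y} \<in> edges G - {e}}"
  have n: "3 \<le> n" and d: "distinct vs"
    and E: "\<And>i. i < n \<Longrightarrow> {vs ! i, vs ! (Suc i mod n)} \<in> edges G"
    using assms(2) by (auto simp: is_cycle_def n_def)
  have e: "e \<in> edges G" using E[of "n - 1"] n by (simp add: e_def)
  have path: "(vs ! 0, vs ! i) \<in> R\<^sup>*" if "i < n" for i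
    using that
  proof (induction i)
    case (Suc i)
    have "{vs ! i, vs ! Suc i} \<in> edges G" using E[of i] Suc.prems by simp
    \<comment> \<open>The pair could equal \<open>e\<close> in two orientations. This fact excludes
      one, the next excludes the other, using that the cycle has length at least 3.\<close>
    moreover have "vs ! i \<noteq> vs ! (n - 1)"
      using Suc.prems n nth_eq_iff_index_eq[OF d, of i "n - 1"] by (simp add: n_def)
    moreover have "vs ! i \<noteq> vs ! 0 \<or> vs ! Suc i \<noteq> vs ! (n - 1)"
      using Suc.prems n nth_eq_iff_index_eq[OF d, of i 0] nth_eq_iff_index_eq[OF d, of "Suc i" "n - 1"]
      unfolding n_def by linarith
    ultimately have "{vs ! i, vs ! Suc i} \<in> edges G - {e}"
      by (auto simp: e_def doubleton_eq_iff)
    then have "(vs ! i, vs ! Suc i) \<in> R" by (simp add: R_def)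
    with Suc show ?case by (auto intro: rtrancl_into_rtrancl)
  qed simp
  \<comment> \<open>The detour must be reversible, as \<open>e\<close> may be traversed in either
    direction.\<close>
  have "sym R" by (auto simp: R_def sym_def insert_commute)
  then have sym: "sym (R\<^sup>*)" by (rule sym_rtrancl)
  have "{(x, y). {x, y} \<in> edges G} \<subseteq> R\<^sup>*"
  proof (clarify)
    fix x y assume xy: "{x, y} \<in> edges G"
    show "(x, y) \<in> R\<^sup>*"
    proof (cases "{x, y} = e")
      case True
      then show ?thesis
        using path[of "n - 1"] n symD[OF sym] by (auto simp: e_def doubleton_eq_iff)
    qed (use xy in \<open>auto simp: R_def\<close>)
  qed
  then have "{(x, y). {x, y} \<in> edges G}\<^sup>* \<subseteq> R\<^sup>*" by (rule rtrancl_subset_rtrancl)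
  then have "connected_graph (verts G, edges G - {e})"
    using assms(1) unfolding connected_graph_def R_def by auto
  with e show ?thesis by (rule that)
qed

section \<open>Connected subgraphs of a path and the excluded small paths\<close>

text \<open>The positions in \<open>xs\<close> of vertices of \<open>F\<close> form an interval all
  of whose consecutive pairs are edges, since a gap would disconnect \<open>F\<close>. With at most
  4 entries this contradicts the exclusion of the small paths.\<close>

lemma connected_graph_in_path:
  assumes F: "simple_graph F" "connected_graph F" and d: "distinct xs"
    and V: "verts F \<subseteq> set xs"
    and E: "edges F \<subseteq> {{xs ! i, xs ! Suc i} | i. Suc i < length xs}"
  shows "\<exists>k\<in>{1..length xs}. graph_iso F (path_graph k)"
proof -
  define I where "I = {i. i < length xs \<and> xs ! i \<in> verts F}"
  have fin: "finite I" by (simp add: I_def)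
  have "verts F \<noteq> {}" using F by (simp add: connected_graph_def)
  then have ne: "I \<noteq> {}" using V by (force simp: I_def in_set_conv_nth)
  define l where "l = Min I"
  define u where "u = Max I"
  have l: "l \<in> I" "\<And>i. i \<in> I \<Longrightarrow> l \<le> i" and u: "u \<in> I" "\<And>i. i \<in> I \<Longrightarrow> i \<le> u"
    using fin ne by (auto simp: l_def u_def)
  have lu: "l \<le> u" "u < length xs" using l u by (auto simp: I_def)
  have idx: "xs ! i = xs ! j \<longleftrightarrow> i = j" if "i < length xs" "j < length xs" for i j
    using d that by (simp add: nth_eq_iff_index_eq)
  have edge: "{xs ! j, xs ! Suc j} \<in> edges F" if j: "l \<le> j" "j < u" for j
  proof -
    \<comment> \<open>The end positions \<open>l\<close> and \<open>u\<close> lie on opposite sides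
      of the cut after \<open>j\<close>, and the only consecutive pair across this cut is the one at
      \<open>j\<close>.\<close>
    let ?X = "{xs ! i | i. i \<le> j}"
    have "xs ! l \<in> verts F" "xs ! l \<in> ?X" "xs ! u \<in> verts F" using l u j by (auto simp: I_def)
    moreover have "xs ! u \<notin> ?X" using idx lu j by auto
    ultimately obtain x y where xy: "{x, y} \<in> edges F" "x \<in> ?X" "y \<notin> ?X"
      by (rule connected_graph_cut[OF F(2)])
    obtain i where i: "Suc i < length xs" "{x, y} = {xs ! i, xs ! Suc i}" using xy E by blast
    have "i = j"
    proof -
      consider "x = xs ! i" "y = xs ! Suc i" | "x = xs ! Suc i" "y = xs ! i"
        using i(2) by (auto simp: doubleton_eq_iff)
      then show ?thesis
      proof cases
        case 1
        then have "\<not> Suc i \<le> j" using xy by blast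
        moreover obtain i' where "i' \<le> j" "x = xs ! i'" using xy by blast
        ultimately show ?thesis using 1 idx[of i i'] i lu j by simp
      next
        \<comment> \<open>This orientation is impossible: with \<open>Suc i\<close> the prefix would
          also contain \<open>i\<close>.\<close>
        case 2
        then have "\<not> i \<le> j" using xy by blast
        moreover obtain i' where "i' \<le> j" "x = xs ! i'" using xy by blast
        ultimately show ?thesis using 2 idx[of "Suc i" i'] i lu j by simp
      qed
    qed
    with i xy show ?thesis by simp
  qed
  have mem: "xs ! i \<in> verts F" if "l \<le> i" "i \<le> u" for i
  proof (cases "i < u")
    case True
    then show ?thesis using simple_graph_edge(1)[OF F(1) edge] that by auto
  next
    case False
    then show ?thesis using that u by (simp add: I_def)
  qed
  \<comment> \<open>The number of positions from \<open>l\<close> to \<open>u\<close>, both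
    included.\<close>
  define k where "k = Suc (u - l)"
  have vF: "verts F = (\<lambda>i. xs ! (l + i)) ` {..<k}"
  proof (intro set_eqI iffI)
    fix x assume "x \<in> verts F"
    then obtain i where "i \<in> I" "x = xs ! i" using V by (force simp: I_def in_set_conv_nth)
    then show "x \<in> (\<lambda>i. xs ! (l + i)) ` {..<k}"
      using l(2)[of i] u(2)[of i] by (intro image_eqI[of _ _ "i - l"]) (auto simp: k_def)
  qed (use mem lu in \<open>auto simp: k_def\<close>)
  have bij: "bij_betw (\<lambda>i. xs ! (l + i)) (verts (path_graph k)) (verts F)"
    using vF idx lu by (auto simp: bij_betw_def path_graph_def inj_on_def k_def)
  have "{i, j} \<in> edges (path_graph k) \<longleftrightarrow> {xs ! (l + i), xs ! (l + j)} \<in> edges F"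
    if ij: "i < k" "j < k" for i j
  proof
    assume "{i, j} \<in> edges (path_graph k)"
    then obtain a where "Suc a < k" "{i, j} = {a, Suc a}" by (auto simp: path_graph_def)
    then show "{xs ! (l + i), xs ! (l + j)} \<in> edges F"
      using edge[of "l + a"] by (auto simp: k_def doubleton_eq_iff insert_commute)
  next
    assume "{xs ! (l + i), xs ! (l + j)} \<in> edges F"
    then obtain a where a: "Suc a < length xs" "{xs ! (l + i), xs ! (l + j)} = {xs ! a, xs ! Suc a}"
      using E by blast
    then have "l + i = a \<and> l + j = Suc a \<or> l + i = Suc a \<and> l + j = a"
      using idx ij lu by (auto simp: k_def doubleton_eq_iff)
    then have "j = Suc i \<or> i = Suc j" by auto
    then show "{i, j} \<in> edges (path_graph k)"
      using ij by (auto simp: path_graph_def insert_commute)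
  qed
  then have "graph_iso (path_graph k) F"
    unfolding graph_iso_def using bij
    by (intro exI[of _ "\<lambda>i. xs ! (l + i)"]) (auto simp: path_graph_def)
  then have "graph_iso F (path_graph k)" by (rule graph_iso_sym)
  moreover have "k \<in> {1..length xs}" using lu by (simp add: k_def)
  ultimately show ?thesis by (rule bexI)
qed

text \<open>A connected graph with all degrees at most 1 is a single vertex or a single edge, both
  excluded. The bound later absorbs the vertices outside the copy of \<open>H2\<close>, whose degree
  is at most 2.\<close>

lemma admissible_max_degree_ge_2:
  assumes "admissible G"
  shows "2 \<le> max_degree G"
proof -
  have G: "simple_graph G" "connected_graph G" and np: "\<And>k. k \<in> {1..4} \<Longrightarrow> \<not> graph_iso G (path_graph k)"
    using assms by (auto simp: admissible_def)
  obtain v where v: "v \<in> verts G" using G by (auto simp: connected_graph_def)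
  have "edges G \<noteq> {}"
  proof
    assume E: "edges G = {}"
    have "verts G \<subseteq> {v}" by (rule connected_graph_subset[OF G(2)]) (use v E in auto)
    with connected_graph_in_path[OF G, of "[v]"] E np show False by auto
  qed
  then obtain a b where ab: "{a, b} \<in> edges G" "a \<noteq> b"
    by (metis G(1) ex_in_conv simple_graph_edgeE)
  have abV: "a \<in> verts G" using simple_graph_edge(1)[OF G(1) ab(1)] by simp
  have "\<not> verts G \<subseteq> {a, b}"
  proof
    assume V: "verts G \<subseteq> {a, b}"
    have "edges G \<subseteq> {{a, b}}"
      using V by (auto elim!: simple_graph_edgeE[OF G(1)])
    with connected_graph_in_path[OF G, of "[a, b]"] V ab np show False by fastforce
  qed
  then obtain w where w: "w \<in> verts G" "w \<notin> {a, b}" by blast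
  \<comment> \<open>An edge leaving \<open>{a, b}\<close> starts at one of its ends, which therefore
    lies on two edges.\<close>
  obtain x y where xy: "{x, y} \<in> edges G" "x \<in> {a, b}" "y \<notin> {a, b}"
    using connected_graph_cut[OF G(2) abV _ w, of thesis] by auto
  have x: "x \<in> verts G" using simple_graph_edge(1)[OF G(1) xy(1)] by simp
  have "card {{a, b}, {x, y}} \<le> degree G x"
    unfolding degree_def using ab xy simple_graph_finite_edges[OF G(1)]
    by (intro card_mono) auto
  moreover have "card {{a, b}, {x, y}} = 2"
    using xy by (auto simp: card_2_iff doubleton_eq_iff)
  ultimately show ?thesis using degree_le_max_degree[OF G(1) x] by simp
qed

section \<open>Rainbow subgraphs of the coloring\<close>

text \<open>\<open>A\<close> and \<open>E\<close> stand for the copy of \<open>H2\<close> without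
  \<open>e0\<close>, and \<open>f\<close> for the possible edge of the repeated color. Away from
  \<open>A\<close>, \<open>F\<close> could only consist of \<open>f\<close> and the matching edges
  at its ends, a path on at most 4 vertices. Once \<open>F\<close> meets \<open>A\<close>, only
  \<open>f\<close> can lead out of \<open>A\<close>, and it reaches just one matching edge.\<close>

lemma connected_graph_near_matching:
  assumes F: "simple_graph F" "connected_graph F" "\<And>k. k \<in> {1..4} \<Longrightarrow> \<not> graph_iso F (path_graph k)"
    and E: "\<And>e. e \<in> E \<Longrightarrow> e \<subseteq> A"
    and M: "\<And>m. m \<in> M \<Longrightarrow> card m = 2 \<and> m \<inter> A = {}" "M \<noteq> {}"
    and disj: "\<And>m m'. m \<in> M \<Longrightarrow> m' \<in> M \<Longrightarrow> m \<noteq> m' \<Longrightarrow> m \<inter> m' = {}"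
    and VF: "verts F \<subseteq> A \<union> \<Union>M"
    and EF: "edges F \<subseteq> insert f (E \<union> M)"
  obtains m where "m \<in> M" "verts F \<subseteq> A \<union> m" "verts F \<inter> A \<noteq> {}" "edges F \<subseteq> insert f (insert m E)"
proof -
  have VA: "verts F \<inter> A \<noteq> {}"
  proof
    assume VA: "verts F \<inter> A = {}"
    have noE: "e \<notin> E" if "e \<in> edges F" for e
    proof
      assume "e \<in> E"
      then have "e = {}" using E VA simple_graph_edge(1)[OF F(1) that] by blast
      then show False using simple_graph_edge(2)[OF F(1) that] by simp
    qed
    show False
    proof (cases "edges F \<subseteq> M")
      case True
      \<comment> \<open>With matching edges only, \<open>F\<close> stays inside one of them and has
        at most two vertices.\<close>
      obtain v where v: "v \<in> verts F" using F by (auto simp: connected_graph_def)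
      then obtain m where m: "m \<in> M" "v \<in> m" using VA VF by blast
      have sub: "verts F \<subseteq> m"
        by (rule connected_graph_subset[OF F(2)]) (use v m True disj in blast)+
      obtain p q where pq: "m = {p, q}" "p \<noteq> q" using M(1)[OF m(1)] by (auto simp: card_2_iff)
      have "edges F \<subseteq> {{p, q}}"
        using sub unfolding pq by (auto elim!: simple_graph_edgeE[OF F(1)])
      with connected_graph_in_path[OF F(1,2), of "[p, q]"] pq sub F(3) show False by fastforce
    next
      case False
      then have f: "f \<in> edges F" "f \<notin> M" using EF noE by auto
      obtain x y where xy: "f = {x, y}" "x \<noteq> y" "x \<in> verts F" "y \<in> verts F"
        using F(1) f(1) by (rule simple_graph_edgeE)
      obtain m1 m2 where m: "m1 \<in> M" "x \<in> m1" "m2 \<in> M" "y \<in> m2" using xy VA VF by blast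
      obtain x' where x': "m1 = {x', x}" "x' \<noteq> x"
        using M(1)[OF m(1)] m(2) by (auto simp: card_2_iff)
      obtain y' where y': "m2 = {y, y'}" "y \<noteq> y'"
        using M(1)[OF m(3)] m(4) by (auto simp: card_2_iff)
      \<comment> \<open>As \<open>f\<close> is not in the matching, it joins two different matching
        edges, so \<open>x'\<close>, \<open>x\<close>, \<open>y\<close>, \<open>y'\<close> are four
        vertices in path order.\<close>
      have "m1 \<noteq> m2" using f(2) m(1) xy x' y' by (auto simp: doubleton_eq_iff insert_commute)
      then have dm: "m1 \<inter> m2 = {}" using disj m by blast
      have sub: "verts F \<subseteq> m1 \<union> m2"
      proof (rule connected_graph_subset[OF F(2)])
        show "verts F \<inter> (m1 \<union> m2) \<noteq> {}" using xy m by blast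
        fix e assume e: "e \<in> edges F"
        then consider "e = f" | "e \<in> M" using EF noE by blast
        then show "e \<subseteq> m1 \<union> m2 \<or> e \<inter> (m1 \<union> m2) = {}"
        proof cases
          case 2
          then show ?thesis using disj[OF 2 m(1)] disj[OF 2 m(3)] by blast
        qed (use xy m in auto)
      qed
      have "e \<in> {m1, f, m2}" if e: "e \<in> edges F" for e
      proof (rule ccontr)
        assume "e \<notin> {m1, f, m2}"
        then have "e \<in> M" "e \<noteq> m1" "e \<noteq> m2" using EF noE[OF e] e by auto
        then have "e \<inter> m1 = {}" "e \<inter> m2 = {}" using disj m by auto
        then have "e = {}" using simple_graph_edge(1)[OF F(1) e] sub by blast
        then show False using simple_graph_edge(2)[OF F(1) e] by simp
      qed
      moreover have "{m1, f, m2} \<subseteq> {{[x', x, y, y'] ! i, [x', x, y, y'] ! Suc i} | i. Suc i < length [x', x, y, y']}"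
      proof -
        \<comment> \<open>Positions 0, 1 and 2 of the list yield \<open>m1\<close>, \<open>f\<close>
          and \<open>m2\<close>.\<close>
        have "Suc 0 < 4" "Suc 1 < 4" "Suc 2 < (4::nat)" by auto
        then show ?thesis unfolding x' y' xy
          by (auto intro: exI[of _ 0] exI[of _ 1] exI[of _ 2] simp: numeral_2_eq_2)
      qed
      moreover have "distinct [x', x, y, y']" using dm x' y' xy by auto
      moreover have "verts F \<subseteq> set [x', x, y, y']" using sub x' y' by auto
      ultimately have "\<exists>k\<in>{1..length [x', x, y, y']}. graph_iso F (path_graph k)"
        by (intro connected_graph_in_path[OF F(1,2)]) blast+
      then show False using F(3) by auto
    qed
  qed
  have "\<exists>m\<in>M. verts F \<subseteq> A \<union> m"
  \<comment> \<open>Edges of \<open>E\<close> stay inside \<open>A\<close> and those of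
    \<open>M\<close> outside, so only \<open>f\<close> can cross the boundary of
    \<open>A\<close>.\<close>
  proof (cases "f \<in> edges F \<and> f \<inter> A \<noteq> {} \<and> \<not> f \<subseteq> A")
    case True
    then obtain x y where xy: "f = {x, y}" "x \<in> A" "y \<notin> A" "y \<in> verts F"
      by (elim conjE simple_graph_edgeE[OF F(1)]) (auto simp: insert_commute)
    then obtain m where m: "m \<in> M" "y \<in> m" using VF by blast
    have "verts F \<subseteq> A \<union> m"
    proof (rule connected_graph_subset[OF F(2)])
      show "verts F \<inter> (A \<union> m) \<noteq> {}" using VA by blast
      fix e assume "e \<in> edges F"
      then consider "e = f" | "e \<in> E" | "e \<in> M" using EF by blast
      then show "e \<subseteq> A \<union> m \<or> e \<inter> (A \<union> m) = {}"
      proof cases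
        case 3
        then show ?thesis using disj[OF 3 m(1)] M(1)[OF 3] by blast
      qed (use xy m E in auto)
    qed
    with m show ?thesis by blast
  next
    case False
    have "verts F \<subseteq> A"
      by (rule connected_graph_subset[OF F(2) VA]) (use False EF E M(1) in blast)
    \<comment> \<open>Here \<open>F\<close> lies in \<open>A\<close> and any matching edge
      serves.\<close>
    with M(2) show ?thesis by blast
  qed
  then obtain m where m: "m \<in> M" "verts F \<subseteq> A \<union> m" by blast
  \<comment> \<open>A matching edge other than \<open>m\<close> misses both \<open>A\<close> and
    \<open>m\<close>, hence every vertex of \<open>F\<close>.\<close>
  have "e \<in> insert f (insert m E)" if e: "e \<in> edges F" for e
  proof (rule ccontr)
    assume "e \<notin> insert f (insert m E)"
    then have "e \<in> M" "e \<noteq> m" using e EF by auto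
    then have "e \<inter> m = {}" "e \<inter> A = {}" using disj m M(1) by auto
    then have "e = {}" using m(2) simple_graph_edge(1)[OF F(1) e] by blast
    then show False using simple_graph_edge(2)[OF F(1) e] by simp
  qed
  with m VA show ?thesis by (intro that) auto
qed

section \<open>Degree and dimension counts\<close>

text \<open>At a vertex of \<open>H\<close> only \<open>f\<close> can be new; a vertex off
  \<open>H\<close> lies on no edges but \<open>f\<close> and \<open>m\<close>, and 2 does not exceed
  the maximum degree of \<open>H\<close>. So the excess occurs only at the ends of
  \<open>f\<close>.\<close>

lemma degree_near_matching:
  assumes H: "simple_graph H" "2 \<le> max_degree H"
    and F: "simple_graph F" "verts F \<subseteq> verts H \<union> m"
      "edges F \<subseteq> insert f (insert m (edges H))"
    and m: "m \<inter> verts H = {}"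
    and v: "v \<in> verts F"
  shows "degree F v \<le> max_degree H + 1"
    and "degree F v = max_degree H + 1 \<Longrightarrow> v \<in> f \<and> f \<in> edges F"
proof -
  have *: "degree F v \<le> max_degree H + (if v \<in> f \<and> f \<in> edges F then 1 else 0)"
  proof (cases "v \<in> verts H")
    case True
    let ?D = "{e \<in> edges H. v \<in> e}"
    have fin: "finite ?D" using simple_graph_finite_edges[OF H(1)] by simp
    have "{e \<in> edges F. v \<in> e} \<subseteq> (if v \<in> f \<and> f \<in> edges F then {f} else {}) \<union> ?D"
      using F(3) m True by auto
    then have "degree F v \<le> card ((if v \<in> f \<and> f \<in> edges F then {f} else {}) \<union> ?D)"
      unfolding degree_def using fin by (intro card_mono) auto
    also have "\<dots> \<le> card (if v \<in> f \<and> f \<in> edges F then {f} else {}) + card ?D"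
      by (rule card_Un_le)
    also have "\<dots> = (if v \<in> f \<and> f \<in> edges F then 1 else 0) + degree H v"
      by (simp add: degree_def)
    finally show ?thesis using degree_le_max_degree[OF H(1) True] by simp
  next
    case False
    have "{e \<in> edges F. v \<in> e} \<subseteq> {f, m}"
      using F(3) False simple_graph_edge(1)[OF H(1)] by auto
    then have "degree F v \<le> card {f, m}"
      unfolding degree_def by (intro card_mono) auto
    also have "\<dots> \<le> 2" by (simp add: card_insert_if)
    finally show ?thesis using H(2) by simp
  qed
  from * show "degree F v \<le> max_degree H + 1" by (auto split: if_splits)
  from * show "degree F v = max_degree H + 1 \<Longrightarrow> v \<in> f \<and> f \<in> edges F"
    by (auto split: if_splits)
qed

text \<open>\<open>f\<close> replaces the deleted \<open>e0\<close>, and \<open>m\<close> is offset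
  by its two ends. The vertices of \<open>H\<close> missed by \<open>F\<close> cost at least as many
  edges, because \<open>H\<close> without \<open>e0\<close> is still connected.\<close>

lemma graph_dim_near_matching:
  assumes H: "simple_graph H" "e0 \<in> edges H" "connected_graph (verts H, edges H - {e0})"
    and F: "simple_graph F" "verts F \<subseteq> verts H \<union> m" "verts F \<inter> verts H \<noteq> {}"
      "edges F \<subseteq> insert f (insert m (edges H - {e0}))"
    and m: "m \<inter> verts H = {}" "card m = 2"
  shows "graph_dim F \<le> graph_dim H"
proof -
  define X where "X = verts F \<inter> verts H"
  \<comment> \<open>\<open>D\<close> holds the edges that \<open>F\<close> may still use,
    \<open>D'\<close> those lost because an end is not in \<open>F\<close>.\<close>
  define D where "D = {e \<in> edges H - {e0}. e \<subseteq> X}"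
  define D' where "D' = {e \<in> edges H - {e0}. \<not> e \<subseteq> X}"
  note finH = simple_graph_finite_edges[OF H(1)]
  have fin: "finite D" "finite D'" using finH by (auto simp: D_def D'_def)
  have "simple_graph (verts H, edges H - {e0})" using H(1) by (auto simp: simple_graph_def)
  from card_edges_outside_ge[OF this H(3), of X]
  have "card (verts H - X) \<le> card D'" using F(3) by (auto simp: X_def D'_def)
  moreover have "card (verts H - X) = card (verts H) - card X" "card X \<le> card (verts H)"
    using simple_graph_finite_verts[OF H(1)]
    by (auto simp: X_def card_Diff_subset intro: card_mono)
  moreover have "card D + card D' = card (edges H) - 1"
  proof -
    have "card D + card D' = card (D \<union> D')"
      using fin by (intro card_Un_disjoint[symmetric]) (auto simp: D_def D'_def)
    also have "D \<union> D' = edges H - {e0}" by (auto simp: D_def D'_def)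
    finally show ?thesis using H(2) finH by simp
  qed
  \<comment> \<open>This makes the natural subtraction \<open>card (edges H) - 1\<close> exact in
    the final arithmetic.\<close>
  moreover have "card (edges H) \<noteq> 0" using H(2) finH by auto
  moreover have VF: "card (verts F) = card X + card (verts F \<inter> m)"
  proof -
    have "verts F = X \<union> (verts F \<inter> m)" using F(2) by (auto simp: X_def)
    moreover have "card (X \<union> (verts F \<inter> m)) = card X + card (verts F \<inter> m)"
      using simple_graph_finite_verts[OF F(1)] m by (intro card_Un_disjoint) (auto simp: X_def)
    ultimately show ?thesis by simp
  qed
  \<comment> \<open>The 1 accounts for \<open>f\<close>. If \<open>m\<close> is an edge of
    \<open>F\<close>, both its ends are in \<open>F\<close> and the last term is 2.\<close>
  moreover have "card (edges F) \<le> card D + 1 + card (verts F \<inter> m)"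
  proof (cases "m \<in> edges F")
    case True
    then have "verts F \<inter> m = m" using simple_graph_edge(1)[OF F(1)] by blast
    then have "card (verts F \<inter> m) = 2" using m by simp
    moreover have "edges F \<subseteq> D \<union> {f, m}"
      using F(4) simple_graph_edge(1)[OF F(1)] simple_graph_edge(1)[OF H(1)]
      by (fastforce simp: D_def X_def)
    then have "card (edges F) \<le> card (D \<union> {f, m})" using fin by (intro card_mono) auto
    moreover have "card (D \<union> {f, m}) \<le> card D + card {f, m}" by (rule card_Un_le)
    moreover have "card {f, m} \<le> 2" by (simp add: card_insert_if)
    ultimately show ?thesis by linarith
  next
    case False
    then have "edges F \<subseteq> insert f D"
      using F(4) simple_graph_edge(1)[OF F(1)] simple_graph_edge(1)[OF H(1)]
      by (fastforce simp: D_def X_def)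
    then have "card (edges F) \<le> card (insert f D)" using fin by (intro card_mono) auto
    also have "\<dots> \<le> Suc (card D)" using fin by (simp add: card_insert_if)
    finally show ?thesis by simp
  qed
  ultimately show ?thesis unfolding graph_dim_def by linarith
qed

section \<open>The coloring and its rainbow copy of \<open>H1\<close>\<close>

text \<open>\<open>e0\<close> and all edges outside \<open>S\<close> share one color, so a rainbow
  graph contains at most one of them, namely \<open>f\<close>.\<close>

lemma rainbow_repeated_color:
  assumes F: "rainbow F c" and e0: "e0 \<in> S" and c: "\<And>e. e \<notin> S \<Longrightarrow> c e = c e0"
  obtains f where "edges F \<subseteq> insert f (S - {e0})"
proof (cases "edges F \<subseteq> S")
  case True
  \<comment> \<open>Inside \<open>S\<close> the only possible exception is \<open>e0\<close>, which
    need not be an edge of \<open>F\<close>.\<close>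
  then show ?thesis by (intro that[of e0]) auto
next
  case False
  then obtain f where f: "f \<in> edges F" "f \<notin> S" by blast
  have "e = f" if "e \<in> edges F" "e \<notin> S - {e0}" for e
    using F that f c e0 unfolding rainbow_def by (metis DiffI inj_onD singletonD)
  then show ?thesis by (intro that[of f]) auto
qed

text \<open>By contraposition of \<open>rainbow_le\<close>, a coloring with enough colors and a
  rainbow copy of \<open>H2\<close> contains a rainbow copy \<open>F\<close> of \<open>H1\<close>.
  The conclusion forgets the coloring and keeps only where the edges of \<open>F\<close> can
  lie.\<close>

lemma rainbow_le_witness:
  fixes H1 :: "'a graph" and H2 :: "'b graph"
  assumes le: "rainbow_le H1 H2" and H2: "simple_graph H2" "e0 \<in> edges H2"
  obtains g :: "'b \<Rightarrow> nat" and M F f where "inj_on g (verts H2)" "subgraph F (complete_graph (g ` verts H2 \<union> \<Union>M))"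
    "graph_iso F H1" "edges F \<subseteq> insert f (edges (map_graph g H2) - {g ` e0} \<union> M)"
    "\<forall>m\<in>M. card m = 2 \<and> m \<inter> g ` verts H2 = {}" "M \<noteq> {}"
    "\<forall>m\<in>M. \<forall>m'\<in>M. m \<noteq> m' \<longrightarrow> m \<inter> m' = {}"
proof -
  obtain t where t: "t > 0" and
    imp: "\<And>(V :: nat set) c. finite V \<Longrightarrow> colored_in_at_least t (complete_graph V) c \<Longrightarrow>
        rainbow_free H1 (complete_graph V) c \<Longrightarrow> rainbow_free H2 (complete_graph V) c"
    using le unfolding rainbow_le_def by blast
  define n where "n = card (verts H2)"
  \<comment> \<open>The copy occupies the numbers below \<open>n\<close>, leaving those from
    \<open>n\<close> on for the matching.\<close>
  obtain g where "bij_betw g (verts H2) {0..<n}"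
    using ex_bij_betw_finite_nat[OF simple_graph_finite_verts[OF H2(1)]] unfolding n_def by blast
  then have g: "inj_on g (verts H2)" and gV: "g ` verts H2 = {..<n}"
    by (auto simp: bij_betw_def)
  define H where "H = map_graph g H2"
  have H: "simple_graph H" unfolding H_def by (rule simple_graph_map_graph[OF H2(1) g])
  have vH: "verts H = {..<n}" by (simp add: H_def gV)
  \<comment> \<open>Disjoint pairs of consecutive numbers from \<open>n\<close> on; \<open>t\<close>
    of them already supply the required number of colors.\<close>
  define m where "m i = {n + 2 * i, Suc (n + 2 * i)}" for i
  define M where "M = m ` {..<t}"
  have inj_m: "inj m" by (auto simp: inj_on_def m_def doubleton_eq_iff)
  have M: "card k = 2 \<and> k \<inter> {..<n} = {}" if "k \<in> M" for k
    using that by (auto simp: M_def m_def)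
  have disj: "k \<inter> k' = {}" if "k \<in> M" "k' \<in> M" "k \<noteq> k'" for k k'
    using that unfolding M_def m_def by auto presburger+
  have finM: "finite M" by (simp add: M_def)
  define V where "V = {..<n} \<union> \<Union>M"
  have finV: "finite V" unfolding V_def using finM by (auto simp: M_def m_def)
  define S where "S = edges H \<union> M"
  have finS: "finite S" using simple_graph_finite_edges[OF H] finM by (simp add: S_def)
  have SV: "S \<subseteq> edges (complete_graph V)"
    using simple_graph_edge[OF H] M unfolding S_def V_def complete_graph_def vH by fastforce
  obtain h :: "nat set \<Rightarrow> nat" where h: "inj_on h S"
    using finite_imp_inj_to_nat_seg[OF finS] by blast
  \<comment> \<open>The default value is the color of the image of \<open>e0\<close>, so no other
    color is repeated.\<close>
  define c where "c e = (if e \<in> S then h e else h (g ` e0))" for e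
  have inj: "inj_on c S" using h by (simp add: c_def inj_on_def)
  have e0: "g ` e0 \<in> edges H" using H2(2) by (simp add: H_def)
  have "t = card M" using card_image[OF inj_on_subset[OF inj_m]] by (simp add: M_def)
  also have "\<dots> \<le> card S" using finS by (intro card_mono) (auto simp: S_def)
  also have "\<dots> = card (c ` S)" by (rule card_image[OF inj, symmetric])
  also have "\<dots> \<le> card (c ` edges (complete_graph V))"
    using SV finV by (intro card_mono) (auto simp: complete_graph_def)
  finally have col: "colored_in_at_least t (complete_graph V) c"
    by (simp add: colored_in_at_least_def)
  have "subgraph H (complete_graph V)"
    using H SV by (auto simp: subgraph_def complete_graph_def vH V_def S_def)
  moreover have "rainbow H c"
    unfolding rainbow_def by (rule inj_on_subset[OF inj]) (simp add: S_def)
  moreover have "graph_iso H H2"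
    unfolding H_def by (rule graph_iso_sym[OF graph_iso_map_graph[OF H2(1) g]])
  ultimately have "\<not> rainbow_free H2 (complete_graph V) c"
    unfolding rainbow_free_def by blast
  with imp[OF finV col] obtain F where F: "subgraph F (complete_graph V)" "rainbow F c" "graph_iso F H1"
    unfolding rainbow_free_def by blast
  have "g ` e0 \<in> S" using e0 by (simp add: S_def)
  moreover have "c e = c (g ` e0)" if "e \<notin> S" for e using that calculation by (simp add: c_def)
  ultimately obtain f where "edges F \<subseteq> insert f (S - {g ` e0})"
    by (rule rainbow_repeated_color[OF F(2)])
  then have EF: "edges F \<subseteq> insert f (edges (map_graph g H2) - {g ` e0} \<union> M)"
    by (auto simp: S_def H_def)
  have ne: "M \<noteq> {}" using t by (auto simp: M_def)
  have FV: "subgraph F (complete_graph (g ` verts H2 \<union> \<Union>M))"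
    using F(1) by (simp add: V_def gV)
  have MH: "\<forall>m\<in>M. card m = 2 \<and> m \<inter> g ` verts H2 = {}"
    using M by (simp add: gV)
  show ?thesis
    by (rule that[OF g FV F(3) EF MH ne]) (use disj in simp)
qed

text \<open>This chooses the edge whose color is repeated: one on a cycle if there is a cycle,
  otherwise any edge, which exists because the maximum degree is positive.\<close>

lemma admissible_edge:
  assumes "admissible G"
  obtains e where "e \<in> edges G" "\<not> is_tree G \<longrightarrow> connected_graph (verts G, edges G - {e})"
proof (cases "is_tree G")
  case True
  have "edges G \<noteq> {}"
  proof
    assume E: "edges G = {}"
    have "verts G \<noteq> {}" using assms unfolding admissible_def connected_graph_def by blast
    moreover have "degree G v = 0" for v by (simp add: degree_def E)
    ultimately have "degree G ` verts G = {0}" by auto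
    then have "max_degree G = 0" by (simp add: max_degree_def)
    with admissible_max_degree_ge_2[OF assms] show False by linarith
  qed
  then obtain e where "e \<in> edges G" by blast
  with True show ?thesis by (intro that) simp_all
next
  case False
  moreover have G: "connected_graph G" using assms by (simp add: admissible_def)
  ultimately obtain vs where "is_cycle G vs" unfolding is_tree_def by blast
  then obtain e where e: "e \<in> edges G" "connected_graph (verts G, edges G - {e})"
    by (rule connected_graph_delete_cycle_edge[OF G])
  show ?thesis by (rule that[OF e(1)]) (use e(2) in blast)
qed

section \<open>The four bounds\<close>

theorem theorem2:
  fixes H1 :: "'a graph" and H2 :: "'b graph"
  assumes "admissible H1" and "admissible H2"
    and "rainbow_le H1 H2"
  shows "card (edges H1) \<le> card (edges H2) + 1 \<and>
    card (verts H1) \<le> card (verts H2) + 2 \<and>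
    (max_degree H1 \<le> max_degree H2 + 1 \<and>
      (max_degree H1 = max_degree H2 + 1 \<longrightarrow>
        card {v \<in> verts H1. degree H1 v = max_degree H1} \<le> 2 \<and>
        (\<forall>u\<in>verts H1. \<forall>v\<in>verts H1.
          u \<noteq> v \<and> degree H1 u = max_degree H2 + 1 \<and> degree H1 v = max_degree H2 + 1 \<longrightarrow>
          {u, v} \<in> edges H1))) \<and>
    (\<not> is_tree H2 \<longrightarrow> graph_dim H1 \<le> graph_dim H2)"
proof -
  have H1: "simple_graph H1" "connected_graph H1"
    and np: "\<And>k. k \<in> {1..4} \<Longrightarrow> \<not> graph_iso H1 (path_graph k)"
    and H2: "simple_graph H2" using assms(1,2) by (auto simp: admissible_def)
  obtain e0 where e0: "e0 \<in> edges H2"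
    and con: "\<not> is_tree H2 \<longrightarrow> connected_graph (verts H2, edges H2 - {e0})"
    using admissible_edge[OF assms(2)] .
  obtain g :: "'b \<Rightarrow> nat" and M F f where g: "inj_on g (verts H2)"
    and F: "subgraph F (complete_graph (g ` verts H2 \<union> \<Union>M))" "graph_iso F H1"
      "edges F \<subseteq> insert f (edges (map_graph g H2) - {g ` e0} \<union> M)"
    and M: "\<forall>m\<in>M. card m = 2 \<and> m \<inter> g ` verts H2 = {}" "M \<noteq> {}"
      "\<forall>m\<in>M. \<forall>m'\<in>M. m \<noteq> m' \<longrightarrow> m \<inter> m' = {}"
    by (rule rainbow_le_witness[OF assms(3) H2 e0])
  define H where "H = map_graph g H2"
  have H: "simple_graph H" unfolding H_def by (rule simple_graph_map_graph[OF H2 g])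
  have ge0: "g ` e0 \<in> edges H" using e0 by (simp add: H_def)
  have F': "simple_graph F" "verts F \<subseteq> verts H \<union> \<Union>M"
    using F(1) by (auto simp: subgraph_def complete_graph_def H_def)
  \<comment> \<open>\<open>F\<close> is now literally a relabelled \<open>H1\<close>, so counts and
    degrees can be read off from \<open>F\<close>.\<close>
  obtain p where p: "inj_on p (verts H1)" "F = map_graph p H1"
    using graph_iso_imp_map_graph[OF H1(1) F'(1) graph_iso_sym[OF F(2)]] .
  have Fc: "connected_graph F" unfolding p(2) by (rule connected_graph_map_graph[OF H1(2)])
  have Fnp: "\<not> graph_iso F (path_graph k)" if "k \<in> {1..4}" for k
    using np[OF that] graph_iso_trans[OF graph_iso_sym[OF F(2)]] by blast
  have sub: "e \<subseteq> verts H" if "e \<in> edges H - {g ` e0}" for e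
    using simple_graph_edge(1)[OF H] that by blast
  \<comment> \<open>\<open>A\<close> is the vertex set of \<open>H\<close>, and \<open>E\<close> is
    its edge set without the image of \<open>e0\<close>.\<close>
  obtain m where m: "m \<in> M" "verts F \<subseteq> verts H \<union> m" "verts F \<inter> verts H \<noteq> {}"
    "edges F \<subseteq> insert f (insert m (edges H - {g ` e0}))"
    by (rule connected_graph_near_matching[OF F'(1) Fc Fnp sub _ M(2) _ F'(2)])
      (use M(1,3) F(3) in \<open>auto simp: H_def\<close>)
  have m2: "card m = 2" "m \<inter> verts H = {}" "finite m"
    using M(1) m(1) by (auto simp: H_def intro: card_ge_0_finite)
  have EF: "edges F \<subseteq> insert f (insert m (edges H))" using m(4) by blast
  have deg2: "2 \<le> max_degree H"
    unfolding H_def max_degree_map_graph[OF H2 g] by (rule admissible_max_degree_ge_2[OF assms(2)])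
  note deg = degree_near_matching[OF H deg2 F'(1) m(2) EF m2(2)]

  have finH: "finite (edges H)" "finite (verts H)"
    using simple_graph_finite_edges[OF H] simple_graph_finite_verts[OF H] by auto
  \<comment> \<open>The edges \<open>f\<close> and \<open>m\<close> are gained and the image of
    \<open>e0\<close> is lost, a net gain of at most one.\<close>
  have "card (edges F) \<le> card (insert f (insert m (edges H - {g ` e0})))"
    using m(4) finH by (intro card_mono) auto
  also have "\<dots> \<le> Suc (Suc (card (edges H - {g ` e0})))"
    using finH by (simp add: card_insert_if)
  also have "\<dots> = card (edges H) + 1" using card_Suc_Diff1[OF finH(1) ge0] by simp
  finally have 1: "card (edges F) \<le> card (edges H) + 1" .

  \<comment> \<open>The 2 counts the ends of \<open>m\<close>.\<close>
  have "card (verts F) \<le> card (verts H \<union> m)" using m(2) m2 finH by (intro card_mono) auto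
  also have "\<dots> \<le> card (verts H) + 2" using card_Un_le[of "verts H" m] m2 by simp
  finally have 2: "card (verts F) \<le> card (verts H) + 2" .

  have "verts H1 \<noteq> {}" using H1 by (simp add: connected_graph_def)
  have degF: "degree F (p v) = degree H1 v" if "v \<in> verts H1" for v
    unfolding p(2) by (rule degree_map_graph[OF H1(1) p(1) that])
  have pv: "p v \<in> verts F" if "v \<in> verts H1" for v using that p by simp
  have "degree H1 v \<le> max_degree H + 1" if "v \<in> verts H1" for v
    using deg(1)[OF pv[OF that]] degF[OF that] by simp
  then have 3: "max_degree H1 \<le> max_degree H + 1"
    unfolding max_degree_def[of H1] using simple_graph_finite_verts[OF H1(1)] \<open>verts H1 \<noteq> {}\<close> by simp
  \<comment> \<open>Vertices of excess degree go to ends of \<open>f\<close>: that \<open>f\<close>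
    has two ends gives the bound 2, and \<open>f\<close> itself gives the adjacency.\<close>
  have top: "p v \<in> f \<and> f \<in> edges F" if "v \<in> verts H1" "degree H1 v = max_degree H + 1" for v
    using deg(2)[OF pv[OF that(1)]] degF[OF that(1)] that(2) by simp

  have 4: "card {v \<in> verts H1. degree H1 v = max_degree H + 1} \<le> 2" (is "card ?T \<le> 2")
  proof (cases "?T = {}")
    case False
    then have f: "f \<in> edges F" using top by blast
    then have "card f = 2" using simple_graph_edge(2)[OF F'(1)] by simp
    moreover from this have "card (p ` ?T) \<le> card f"
      using top by (intro card_mono) (auto intro: card_ge_0_finite)
    moreover have "card (p ` ?T) = card ?T"
      by (rule card_image[OF inj_on_subset[OF p(1)]]) auto
    ultimately show ?thesis by simp
  qed (metis card.empty zero_le)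

  have 5: "{u, v} \<in> edges H1"
    if uv: "u \<in> verts H1" "v \<in> verts H1" "u \<noteq> v"
      "degree H1 u = max_degree H + 1" "degree H1 v = max_degree H + 1" for u v
  proof -
    have f: "p u \<in> f" "p v \<in> f" "f \<in> edges F" using top uv by auto
    have "p u \<noteq> p v" using uv p(1) by (auto simp: inj_on_def)
    moreover obtain x y where "f = {x, y}"
      using F'(1) f(3) by (rule simple_graph_edgeE)
    ultimately have "f = {p u, p v}" using f by auto
    then show ?thesis using f(3) doubleton_mem_map_graph[OF H1(1) p(1) uv(1,2)] p(2) by simp
  qed

  have 6: "graph_dim F \<le> graph_dim H" if "\<not> is_tree H2"
  proof (rule graph_dim_near_matching[OF H ge0 _ F'(1) m(2,3,4) m2(2,1)])
    \<comment> \<open>As \<open>g\<close> is injective on edges, deleting \<open>e0\<close> commutes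
      with relabelling, and connectivity carries over from \<open>H2\<close> without
      \<open>e0\<close>.\<close>
    have "(`) g ` (edges H2 - {e0}) = edges H - {g ` e0}"
      unfolding H_def using inj_on_image_set_diff[OF inj_on_image_edges[OF H2 g], of "edges H2" "{e0}"] e0
      by simp
    then have "(verts H, edges H - {g ` e0}) = map_graph g (verts H2, edges H2 - {e0})"
      by (simp add: map_graph_def H_def)
    then show "connected_graph (verts H, edges H - {g ` e0})"
      using connected_graph_map_graph con that by metis
  qed

  have eqs: "card (edges F) = card (edges H1)" "card (verts F) = card (verts H1)"
    "card (edges H) = card (edges H2)" "card (verts H) = card (verts H2)"
    "max_degree H = max_degree H2"
    unfolding p(2) H_def
    by (rule card_edges_map_graph card_verts_map_graph max_degree_map_graph H1 H2 g p)+
  show ?thesis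
    using 1 2 3 4 5 6 unfolding eqs graph_dim_def by auto
qed

end
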